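(* Put $$k_0:=\frac{e^{\tau\omega}-1}{\tau\,\|\mathcal B\|_{\mathcal L(\mathcal H)}\,M\,e^{\tau\omega}}>0 .$$ For every real $k$ with $|k|<k_0$ there is a constant $\gamma(|k|)>0$ (depending on $|k|$) such that the following holds. Let $F:\mathcal H\to\mathcal H$ satisfy $F(0)=0$ and $\|F(U_1)-F(U_2)\|_{\mathcal H}\le\gamma\|U_1-U_2\|_{\mathcal H}$ for all $U_1,U_2\in\mathcal H$, with a constant $0<\gamma<\gamma(|k|)$. Then there exist $\omega'>0$ and $M'>0$ such that, for all $U_0\in\mathcal H$ and $f\in C([0,\tau];\mathcal H)$, the (mild) solution $U\in C([0,+\infty),\mathcal H)$ of $$U_t(t)=\mathcal A U(t)+F(U(t))+k\mathcal B U(t-\tau)\ \text{ in }(0,+\infty),\qquad U(0)=U_0,\qquad \mathcal B U(t-\tau)=f(t)\ \ \forall t\in(0,\tau),$$ satisfies $$\|U(t)\|_{\mathcal H}\le M'e^{-\omega' t}\Big(\|U_0\|_{\mathcal H}+\int_0^\tau e^{\omega s}\|f(s)\|_{\mathcal H}\,ds\Big),\qquad \forall t\ge\tau .$$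
   Context: $\mathcal H$ is a Hilbert space with norm $\|\cdot\|_{\mathcal H}$. The operator $\mathcal A$ on $\mathcal H$ generates a $C_0$-semigroup $(S(t))_{t\ge0}$ that is exponentially stable; $M,\omega>0$ are fixed constants with $\|S(t)\|_{\mathcal L(\mathcal H)}\le Me^{-\omega t}$ for all $t\ge0$. The delay $\tau>0$ is fixed and $\mathcal B\in\mathcal L(\mathcal H)$ is a bounded linear operator (if $\mathcal B=0$, read $k_0=+\infty$). A mild solution is a function $U\in C([0,+\infty),\mathcal H)$ with $$U(t)=S(t)U_0+\int_0^t S(t-s)[F(U(s))+k\mathcal B U(s-\tau)]\,ds,\quad t\ge0,$$ where $\mathcal B U(s-\tau)$ stands for $f(s)$ when $s\in(0,\tau)$; it exists and is unique for globally Lipschitz $F$. *)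

theory Defs
  imports "HOL-Analysis.Analysis"
begin

definition C0_semigroup :: "(real \<Rightarrow> 'a::real_normed_vector \<Rightarrow>\<^sub>L 'a) \<Rightarrow> bool" where
  "C0_semigroup S \<longleftrightarrow>
     S 0 = id_blinfun \<and>
     (\<forall>s\<ge>0. \<forall>t\<ge>0. S (s + t) = S s o\<^sub>L S t) \<and>
     (\<forall>x. ((\<lambda>t. blinfun_apply (S t) x) \<longlongrightarrow> x) (at_right 0))"

(* An unbounded operator is given by its domain D and a total function A of which only the
   values on D matter. Being the generator also fixes D: it is the set of all x for which the
   one-sided derivative of S(t)x at 0 exists. *)
definition generates_C0_semigroup ::
    "'a::real_normed_vector set \<Rightarrow> ('a \<Rightarrow> 'a) \<Rightarrow> (real \<Rightarrow> 'a \<Rightarrow>\<^sub>L 'a) \<Rightarrow> bool" where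
  "generates_C0_semigroup D A S \<longleftrightarrow>
     C0_semigroup S \<and>
     D = {x. \<exists>y. ((\<lambda>h. (blinfun_apply (S h) x - x) /\<^sub>R h) \<longlongrightarrow> y) (at_right 0)} \<and>
     (\<forall>x\<in>D. ((\<lambda>h. (blinfun_apply (S h) x - x) /\<^sub>R h) \<longlongrightarrow> A x) (at_right 0))"

(* The norm of 'a \<Rightarrow>\<^sub>L 'a is the operator norm. *)
definition delay_threshold ::
    "real \<Rightarrow> real \<Rightarrow> real \<Rightarrow> ('a::real_normed_vector \<Rightarrow>\<^sub>L 'a) \<Rightarrow> ereal" where
  "delay_threshold \<tau> M \<omega> B =
     (if B = 0 then \<infinity>
      else ereal ((exp (\<tau> * \<omega>) - 1) / (\<tau> * norm B * M * exp (\<tau> * \<omega>))))"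

(* The term B U(s - \<tau>), in which the history f replaces the whole of B U(s - \<tau>), not U(s - \<tau>),
   for s < \<tau>. *)
definition delayed_term ::
    "real \<Rightarrow> ('a::real_normed_vector \<Rightarrow>\<^sub>L 'a) \<Rightarrow> (real \<Rightarrow> 'a) \<Rightarrow> (real \<Rightarrow> 'a) \<Rightarrow> real \<Rightarrow> 'a" where
  "delayed_term \<tau> B f U s = (if s < \<tau> then f s else blinfun_apply B (U (s - \<tau>)))"

(* Mild solution of U' = A U + F(U) + k B U(t - \<tau>), with S the semigroup generated by A.
   Only the values of U on [0, \<infinity>) matter. For continuous F, U and f the integrand is piecewise
   continuous with at most a jump at s = \<tau>, hence integrable. The Henstock-Kurzweil integral is
   used because, unlike the library's Bochner integral, it does not require the
   target space to be separable. *)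
definition mild_solution ::
    "(real \<Rightarrow> 'a::real_normed_vector \<Rightarrow>\<^sub>L 'a) \<Rightarrow> ('a \<Rightarrow> 'a) \<Rightarrow> real \<Rightarrow> ('a \<Rightarrow>\<^sub>L 'a) \<Rightarrow> real \<Rightarrow>
     'a \<Rightarrow> (real \<Rightarrow> 'a) \<Rightarrow> (real \<Rightarrow> 'a) \<Rightarrow> bool" where
  "mild_solution S F k B \<tau> U0 f U \<longleftrightarrow>
     continuous_on {0..} U \<and>
     (\<forall>t\<ge>0. U t = blinfun_apply (S t) U0 +
        integral {0..t}
          (\<lambda>s. blinfun_apply (S (t - s)) (F (U s) + k *\<^sub>R delayed_term \<tau> B f U s)))"

end

theory Submission imports Defs begin

text \<open>
  Write the solution in the exponentially weighted form \<open>w t = exp (\<omega>' * t) * norm (U t)\<close>. Convolution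
  with the semigroup maps a forcing of size \<open>c * exp (- \<omega>' * s)\<close> to a term of weighted size at most
  \<open>M * c / (\<omega> - \<omega>')\<close>, and a shift by the delay costs a factor \<open>exp (\<omega>' * \<tau>)\<close>. Hence, if \<open>W\<close> is the
  maximum of \<open>w\<close> on a compact interval \<open>[0, T]\<close>, the variation-of-constants formula evaluated at a
  point where \<open>w\<close> attains \<open>W\<close> gives
  \<open>W \<le> q * W + M * (norm U0 + \<bar>k\<bar> * J)\<close>, where \<open>J\<close> is the weighted integral of the history and
  \<open>q = M * (\<gamma> + \<bar>k\<bar> * norm B * exp (\<omega>' * \<tau>)) / (\<omega> - \<omega>')\<close>. As soon as \<open>q < 1\<close>, the term \<open>q * W\<close> can be
  absorbed on the left, which bounds \<open>w\<close> on \<open>[0, T]\<close> by a constant that does not depend on \<open>T\<close>.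
  The convolution bound is \<open>norm_convolution_le\<close>, the absorption \<open>mild_solution_decay\<close>.

  By continuity in \<open>\<omega>'\<close> at \<open>0\<close>, some \<open>\<omega>' > 0\<close> makes \<open>q < 1\<close> whenever
  \<open>M * (\<gamma> + \<bar>k\<bar> * norm B) < \<omega>\<close>. This is where the threshold \<open>k0\<close> enters: if \<open>B \<noteq> 0\<close>, it satisfies
  \<open>k0 * norm B * M = (1 - exp (- \<tau> * \<omega>)) / \<tau> \<le> \<omega>\<close>, so that \<open>\<gamma>0 \<bar>k\<bar> = \<omega> / M - \<bar>k\<bar> * norm B\<close> is
  positive for \<open>\<bar>k\<bar> < k0\<close>.
\<close>

section \<open>The delay threshold and the choice of the decay rate\<close>

lemma delay_threshold_pos:
  assumes "M > 0" "\<omega> > 0" "\<tau> > 0"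
  shows "0 < delay_threshold \<tau> M \<omega> B"
  using assms by (auto simp: delay_threshold_def)

text \<open>The elementary inequality \<open>1 - exp (- x) \<le> x\<close>, with \<open>x = \<tau> * \<omega>\<close>, shows that below the
  threshold the delayed feedback alone is weaker than the decay of the semigroup.\<close>

lemma delay_gain_less_decay_rate:
  assumes "M > 0" "\<omega> > 0" "\<tau> > 0"
    and k: "ereal \<bar>k\<bar> < delay_threshold \<tau> M \<omega> B"
  shows "M * (\<bar>k\<bar> * norm B) < \<omega>"
proof (cases "B = 0")
  case True
  then show ?thesis using assms by simp
next
  case False
  define E where "E = exp (\<tau> * \<omega>)"
  have E: "E > 0" by (simp add: E_def)
  have "1 + - (\<tau> * \<omega>) \<le> exp (- (\<tau> * \<omega>))" by (rule exp_ge_add_one_self)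
  then have "(1 - \<tau> * \<omega>) * E \<le> exp (- (\<tau> * \<omega>)) * E"
    using E by (intro mult_right_mono) auto
  then have "E - 1 \<le> \<tau> * \<omega> * E"
    by (simp add: E_def exp_minus algebra_simps)
  moreover have "\<bar>k\<bar> * (\<tau> * norm B * M * E) < E - 1"
    using k False assms E by (simp add: delay_threshold_def E_def pos_less_divide_eq)
  ultimately have "(\<tau> * E) * (M * (\<bar>k\<bar> * norm B)) < (\<tau> * E) * \<omega>"
    by (simp add: algebra_simps)
  then show ?thesis using E assms by simp
qed

lemma exists_decay_rate:
  fixes M \<omega> \<tau> a b :: real
  assumes "M * (a + b) < \<omega>"
  obtains \<omega>' where "0 < \<omega>'" "M * (a + b * exp (\<omega>' * \<tau>)) < \<omega> - \<omega>'"
proof -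
  have "((\<lambda>x. M * (a + b * exp (x * \<tau>)) + x) \<longlongrightarrow> M * (a + b * exp (0 * \<tau>)) + 0) (at_right 0)"
    by (intro tendsto_intros)
  then have "\<forall>\<^sub>F x in at_right 0. M * (a + b * exp (x * \<tau>)) + x < \<omega>"
    using assms by (intro order_tendstoD(2)) auto
  then have "\<forall>\<^sub>F x in at_right 0. M * (a + b * exp (x * \<tau>)) + x < \<omega> \<and> 0 < x"
    using eventually_at_right_less by (rule eventually_conj)
  then obtain x where "M * (a + b * exp (x * \<tau>)) + x < \<omega>" "0 < x"
    by (auto dest: eventually_happens'[OF trivial_limit_at_right_real])
  then show thesis by (intro that[of x]) auto
qed

section \<open>Convolution with an exponentially stable semigroup\<close>

text \<open>A non-integrable function has integral \<open>0\<close> by convention, so the bound by an integrable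
  majorant holds for it as well. The integrand \<open>s \<mapsto> S (t - s) (G s)\<close> of the variation-of-constants
  formula can thus be estimated from pointwise norm bounds alone.\<close>

lemma norm_integral_le_majorant:
  fixes f :: "'n::euclidean_space \<Rightarrow> 'a::banach" and g :: "'n \<Rightarrow> real"
  assumes g: "g integrable_on X" and le: "\<And>x. x \<in> X \<Longrightarrow> norm (f x) \<le> g x"
  shows "norm (integral X f) \<le> integral X g"
proof (cases "f integrable_on X")
  case True
  then show ?thesis using g le by (rule integral_norm_bound_integral)
next
  case False
  have "0 \<le> integral X g"
    by (rule integral_nonneg[OF g]) (rule order_trans[OF norm_ge_zero le])
  then show ?thesis using False by (simp add: not_integrable_integral)
qed

text \<open>The forcing is split into a part decaying at the slower rate \<open>\<omega>'\<close>, for which the convolution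
  gains the factor \<open>1 / (\<omega> - \<omega>')\<close>, and a part controlled only through its integral with the full
  weight \<open>exp (\<omega> * s)\<close>, as the history of the delay equation is.\<close>

lemma norm_convolution_le:
  fixes S :: "real \<Rightarrow> 'a::banach \<Rightarrow>\<^sub>L 'a" and G :: "real \<Rightarrow> 'a" and \<phi> :: "real \<Rightarrow> real"
  assumes stable: "\<And>t. t \<ge> 0 \<Longrightarrow> norm (S t) \<le> M * exp (- \<omega> * t)"
    and "M \<ge> 0" "c \<ge> 0" "\<omega>' < \<omega>" "t \<ge> 0"
    and G: "\<And>s. s \<in> {0..t} \<Longrightarrow> norm (G s) \<le> c * exp (- \<omega>' * s) + \<phi> s"
    and \<phi>: "(\<lambda>s. exp (\<omega> * s) * \<phi> s) integrable_on {0..t}"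
    and J: "0 \<le> J" "integral {0..t} (\<lambda>s. exp (\<omega> * s) * \<phi> s) \<le> J"
  shows "norm (integral {0..t} (\<lambda>s. S (t - s) (G s)))
    \<le> exp (- \<omega>' * t) * (M * c / (\<omega> - \<omega>') + M * J)"
proof -
  define \<delta> where "\<delta> = \<omega> - \<omega>'"
  have \<delta>: "\<delta> > 0" using assms by (simp add: \<delta>_def)
  let ?g = "\<lambda>s. M * exp (- \<omega> * t) * (c * exp (\<delta> * s) + exp (\<omega> * s) * \<phi> s)"
  have "((\<lambda>s. exp (\<delta> * s)) has_integral exp (\<delta> * t) / \<delta> - exp (\<delta> * 0) / \<delta>) {0..t}"
    using \<delta> \<open>t \<ge> 0\<close> by (intro fundamental_theorem_of_calculus)
      (auto simp flip: has_real_derivative_iff_has_vector_derivative intro!: derivative_eq_intros)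
  from has_integral_mult_right[OF this, of c]
  have "((\<lambda>s. c * exp (\<delta> * s)) has_integral c * (exp (\<delta> * t) / \<delta> - 1 / \<delta>)) {0..t}"
    by simp
  from has_integral_mult_right[OF has_integral_add[OF this integrable_integral[OF \<phi>]]]
  have g: "(?g has_integral M * exp (- \<omega> * t) * (c * (exp (\<delta> * t) / \<delta> - 1 / \<delta>)
      + integral {0..t} (\<lambda>s. exp (\<omega> * s) * \<phi> s))) {0..t}" .
  have majorant: "norm (S (t - s) (G s)) \<le> ?g s" if s: "s \<in> {0..t}" for s
  proof -
    have "norm (S (t - s) (G s)) \<le> norm (S (t - s)) * norm (G s)"
      by (rule norm_blinfun)
    also have "\<dots> \<le> M * exp (- \<omega> * (t - s)) * (c * exp (- \<omega>' * s) + \<phi> s)"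
      using s \<open>M \<ge> 0\<close> by (intro mult_mono stable G) auto
    also have "exp (- \<omega> * (t - s)) = exp (- \<omega> * t) * exp (\<omega> * s)"
      by (simp add: algebra_simps flip: exp_add)
    also have "M * (exp (- \<omega> * t) * exp (\<omega> * s)) * (c * exp (- \<omega>' * s) + \<phi> s)
        = M * exp (- \<omega> * t) * (c * (exp (\<omega> * s) * exp (- \<omega>' * s)) + exp (\<omega> * s) * \<phi> s)"
      by (simp add: algebra_simps)
    also have "exp (\<omega> * s) * exp (- \<omega>' * s) = exp (\<delta> * s)"
      by (simp add: \<delta>_def algebra_simps flip: exp_add)
    finally show ?thesis .
  qed
  have "norm (integral {0..t} (\<lambda>s. S (t - s) (G s))) \<le> integral {0..t} ?g"
    using g majorant by (intro norm_integral_le_majorant) auto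
  also have "\<dots> = M * exp (- \<omega> * t) * (c * (exp (\<delta> * t) / \<delta> - 1 / \<delta>)
      + integral {0..t} (\<lambda>s. exp (\<omega> * s) * \<phi> s))"
    using g by (rule integral_unique)
  also have "\<dots> \<le> M * exp (- \<omega> * t) * (exp (\<delta> * t) * (c / \<delta>) + exp (\<delta> * t) * J)"
  proof (intro mult_left_mono add_mono)
    show "c * (exp (\<delta> * t) / \<delta> - 1 / \<delta>) \<le> exp (\<delta> * t) * (c / \<delta>)"
      using \<delta> \<open>c \<ge> 0\<close> by (simp add: field_simps)
    have "1 * J \<le> exp (\<delta> * t) * J"
      using \<delta> \<open>t \<ge> 0\<close> J by (intro mult_right_mono) auto
    then show "integral {0..t} (\<lambda>s. exp (\<omega> * s) * \<phi> s) \<le> exp (\<delta> * t) * J"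
      using J by simp
  qed (use \<open>M \<ge> 0\<close> in auto)
  also have "\<dots> = (exp (- \<omega> * t) * exp (\<delta> * t)) * (M * c / \<delta> + M * J)"
    by (simp add: algebra_simps)
  also have "exp (- \<omega> * t) * exp (\<delta> * t) = exp (- \<omega>' * t)"
    by (simp add: \<delta>_def algebra_simps flip: exp_add)
  finally show ?thesis by (simp add: \<delta>_def)
qed

section \<open>The decay estimate\<close>

text \<open>The absorption argument: the variation-of-constants formula at a maximum point of the weighted
  norm bounds the maximum \<open>W\<close> by \<open>q * W\<close> plus the data, where \<open>q < 1\<close> restates the hypothesis
  on the rate \<open>\<omega>'\<close>. The maximum is taken over \<open>[0, T]\<close> and is finite by continuity of \<open>U\<close>.\<close>

lemma mild_solution_decay:
  fixes S :: "real \<Rightarrow> 'a::banach \<Rightarrow>\<^sub>L 'a"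
  assumes stable: "\<And>t. t \<ge> 0 \<Longrightarrow> norm (S t) \<le> M * exp (- \<omega> * t)"
    and "M > 0" "\<tau> > 0" "\<gamma> > 0"
    and F: "\<And>x. norm (F x) \<le> \<gamma> * norm x"
    and rate: "M * (\<gamma> + \<bar>k\<bar> * norm B * exp (\<omega>' * \<tau>)) < \<omega> - \<omega>'"
    and f: "continuous_on {0..\<tau>} f"
    and U: "mild_solution S F k B \<tau> U0 f U"
    and "T \<ge> 0"
  defines "q \<equiv> M * (\<gamma> + \<bar>k\<bar> * norm B * exp (\<omega>' * \<tau>)) / (\<omega> - \<omega>')"
  shows "norm (U T) \<le> M * (1 + \<bar>k\<bar>) / (1 - q) * exp (- \<omega>' * T) *
    (norm U0 + integral {0..\<tau>} (\<lambda>s. exp (\<omega> * s) * norm (f s)))"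
proof -
  define c where "c = \<gamma> + \<bar>k\<bar> * norm B * exp (\<omega>' * \<tau>)"
  define I where "I = integral {0..\<tau>} (\<lambda>s. exp (\<omega> * s) * norm (f s))"
  have c: "c > 0" using \<open>\<gamma> > 0\<close> by (simp add: c_def add_pos_nonneg)
  have "0 < M * c" using c \<open>M > 0\<close> by simp
  then have \<omega>': "\<omega>' < \<omega>" using rate unfolding c_def by linarith
  have q: "q < 1" using rate \<omega>' by (simp add: q_def)
  have f_int: "(\<lambda>s. exp (\<omega> * s) * norm (f s)) integrable_on {0..\<tau>}"
    using f by (intro integrable_continuous_interval continuous_intros)
  have I: "I \<ge> 0" unfolding I_def by (rule integral_nonneg[OF f_int]) simp
  define w where "w t = exp (\<omega>' * t) * norm (U t)" for t
  have "continuous_on {0..T} U"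
    using U continuous_on_subset[of "{0..}" U "{0..T}"] by (auto simp: mild_solution_def)
  then have "continuous_on {0..T} w"
    unfolding w_def by (intro continuous_intros)
  then obtain t where t: "t \<in> {0..T}" and max: "\<And>s. s \<in> {0..T} \<Longrightarrow> w s \<le> w t"
    using continuous_attains_sup[of "{0..T}" w] \<open>T \<ge> 0\<close> by auto
  define W where "W = w t"
  have W: "W \<ge> 0" by (simp add: W_def w_def)
  have U_le: "norm (U s) \<le> W * exp (- \<omega>' * s)" if "s \<in> {0..T}" for s
    using max[OF that] by (simp add: W_def w_def exp_minus field_simps)

  \<comment> \<open>The history is extended by zero, so that it can be integrated over \<open>[0, t]\<close> whether or not
    \<open>t\<close> exceeds the delay.\<close>
  define \<phi> where "\<phi> s = (if s \<in> {0..\<tau>} then \<bar>k\<bar> * norm (f s) else 0)" for s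
  have restrict: "(\<lambda>s. exp (\<omega> * s) * \<phi> s)
      = (\<lambda>s. if s \<in> {0..\<tau>} then \<bar>k\<bar> * (exp (\<omega> * s) * norm (f s)) else 0)"
    by (auto simp: \<phi>_def fun_eq_iff)
  have inter: "{0..\<tau>} \<inter> {0..t} = {0..min \<tau> t}" by auto
  have kf_int: "(\<lambda>s. \<bar>k\<bar> * (exp (\<omega> * s) * norm (f s))) integrable_on {0..min \<tau> t}"
    using f by (intro integrable_continuous_interval continuous_intros)
      (auto intro: continuous_on_subset)
  have \<phi>_int: "(\<lambda>s. exp (\<omega> * s) * \<phi> s) integrable_on {0..t}"
    unfolding restrict integrable_restrict_Int inter by (rule kf_int)
  have "integral {0..t} (\<lambda>s. exp (\<omega> * s) * \<phi> s)
      = integral {0..min \<tau> t} (\<lambda>s. \<bar>k\<bar> * (exp (\<omega> * s) * norm (f s)))"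
    unfolding restrict integral_restrict_Int inter ..
  also have "\<dots> \<le> integral {0..\<tau>} (\<lambda>s. \<bar>k\<bar> * (exp (\<omega> * s) * norm (f s)))"
    by (rule integral_subset_le[OF _ kf_int integrable_on_mult_right[OF f_int]]) auto
  also have "\<dots> = \<bar>k\<bar> * I" by (simp add: I_def)
  finally have \<phi>_le: "integral {0..t} (\<lambda>s. exp (\<omega> * s) * \<phi> s) \<le> \<bar>k\<bar> * I" .

  have forcing: "norm (F (U s) + k *\<^sub>R delayed_term \<tau> B f U s)
      \<le> (c * W) * exp (- \<omega>' * s) + \<phi> s" if s: "s \<in> {0..t}" for s
  proof -
    have "norm (F (U s)) \<le> \<gamma> * norm (U s)" by (rule F)
    also have "\<dots> \<le> \<gamma> * (W * exp (- \<omega>' * s))"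
      using s t \<open>\<gamma> > 0\<close> by (intro mult_left_mono U_le) auto
    finally have F_le: "norm (F (U s)) \<le> \<gamma> * (W * exp (- \<omega>' * s))" .
    have delay_le: "norm (k *\<^sub>R delayed_term \<tau> B f U s)
        \<le> \<bar>k\<bar> * norm B * exp (\<omega>' * \<tau>) * (W * exp (- \<omega>' * s)) + \<phi> s"
    proof (cases "s < \<tau>")
      case True
      then show ?thesis using s W by (simp add: delayed_term_def \<phi>_def)
    next
      case False
      have "norm (B (U (s - \<tau>))) \<le> norm B * norm (U (s - \<tau>))"
        by (rule norm_blinfun)
      also have "\<dots> \<le> norm B * (W * exp (- \<omega>' * (s - \<tau>)))"
        using False s t \<open>\<tau> > 0\<close> by (intro mult_left_mono U_le) auto
      also have "exp (- \<omega>' * (s - \<tau>)) = exp (\<omega>' * \<tau>) * exp (- \<omega>' * s)"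
        by (simp add: algebra_simps flip: exp_add)
      finally have "\<bar>k\<bar> * norm (B (U (s - \<tau>)))
          \<le> \<bar>k\<bar> * (norm B * (W * (exp (\<omega>' * \<tau>) * exp (- \<omega>' * s))))"
        by (rule mult_left_mono) simp
      moreover have "0 \<le> \<phi> s" by (simp add: \<phi>_def)
      ultimately show ?thesis
        using False by (simp add: delayed_term_def mult_ac)
    qed
    from norm_triangle_mono[OF F_le delay_le] show ?thesis
      by (simp add: c_def algebra_simps)
  qed

  have "U t = S t U0 + integral {0..t} (\<lambda>s. S (t - s) (F (U s) + k *\<^sub>R delayed_term \<tau> B f U s))"
    using U t by (simp add: mild_solution_def)
  also have "norm \<dots> \<le> exp (- \<omega>' * t) * (M * norm U0)
      + exp (- \<omega>' * t) * (M * (c * W) / (\<omega> - \<omega>') + M * (\<bar>k\<bar> * I))"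
  proof (rule norm_triangle_mono)
    have "norm (S t U0) \<le> norm (S t) * norm U0" by (rule norm_blinfun)
    also have "\<dots> \<le> M * exp (- \<omega> * t) * norm U0"
      using t by (intro mult_right_mono stable) auto
    also have "\<dots> \<le> M * exp (- \<omega>' * t) * norm U0"
      using t \<omega>' \<open>M > 0\<close> by (intro mult_right_mono mult_left_mono) (auto simp: mult_right_mono)
    finally show "norm (S t U0) \<le> exp (- \<omega>' * t) * (M * norm U0)" by (simp add: mult_ac)
    show "norm (integral {0..t} (\<lambda>s. S (t - s) (F (U s) + k *\<^sub>R delayed_term \<tau> B f U s)))
        \<le> exp (- \<omega>' * t) * (M * (c * W) / (\<omega> - \<omega>') + M * (\<bar>k\<bar> * I))"
      using t c W I \<omega>' \<open>M > 0\<close> by (intro norm_convolution_le[OF stable _ _ _ _ forcing \<phi>_int _ \<phi>_le]) auto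
  qed
  also have "\<dots> = exp (- \<omega>' * t) * (q * W + M * (norm U0 + \<bar>k\<bar> * I))"
    by (simp add: q_def c_def algebra_simps)
  finally have "W \<le> q * W + M * (norm U0 + \<bar>k\<bar> * I)"
    by (simp add: W_def w_def exp_minus field_simps)
  also have "norm U0 + \<bar>k\<bar> * I \<le> (1 + \<bar>k\<bar>) * (norm U0 + I)"
    using I by (simp add: algebra_simps)
  finally have "W * (1 - q) \<le> M * ((1 + \<bar>k\<bar>) * (norm U0 + I))"
    using \<open>M > 0\<close> by (simp add: algebra_simps)
  then have W_le: "W \<le> M * (1 + \<bar>k\<bar>) / (1 - q) * (norm U0 + I)"
    using q by (simp add: pos_le_divide_eq mult_ac)
  have "norm (U T) \<le> W * exp (- \<omega>' * T)"
    using \<open>T \<ge> 0\<close> by (intro U_le) auto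
  also have "\<dots> \<le> M * (1 + \<bar>k\<bar>) / (1 - q) * (norm U0 + I) * exp (- \<omega>' * T)"
    using W_le by (rule mult_right_mono) simp
  finally show ?thesis by (simp add: I_def mult_ac)
qed

theorem theorem2p2:
  fixes D :: "'a::{real_inner, banach} set"
    and A :: "'a \<Rightarrow> 'a"
    and S :: "real \<Rightarrow> 'a \<Rightarrow>\<^sub>L 'a"
    and B :: "'a \<Rightarrow>\<^sub>L 'a"
    and M \<omega> \<tau> :: real
  assumes generator: "generates_C0_semigroup D A S"
    and "M > 0" and "\<omega> > 0"
    and stable: "\<And>t. t \<ge> 0 \<Longrightarrow> norm (S t) \<le> M * exp (- \<omega> * t)"
    and "\<tau> > 0"
  shows "0 < delay_threshold \<tau> M \<omega> B \<and>
    (\<exists>\<gamma>0 :: real \<Rightarrow> real. \<forall>k::real. ereal \<bar>k\<bar> < delay_threshold \<tau> M \<omega> B \<longrightarrow>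
       \<gamma>0 \<bar>k\<bar> > 0 \<and>
       (\<forall>(F :: 'a \<Rightarrow> 'a) (\<gamma>::real).
          F 0 = 0 \<longrightarrow> 0 < \<gamma> \<longrightarrow> \<gamma> < \<gamma>0 \<bar>k\<bar> \<longrightarrow>
          (\<forall>U1 U2. norm (F U1 - F U2) \<le> \<gamma> * norm (U1 - U2)) \<longrightarrow>
          (\<exists>\<omega>'>0. \<exists>M'>0. \<forall>(U0 :: 'a) (f :: real \<Rightarrow> 'a) (U :: real \<Rightarrow> 'a).
             continuous_on {0..\<tau>} f \<longrightarrow>
             mild_solution S F k B \<tau> U0 f U \<longrightarrow>
             (\<forall>t\<ge>\<tau>. norm (U t) \<le> M' * exp (- \<omega>' * t) *
                (norm U0 + integral {0..\<tau>} (\<lambda>s. exp (\<omega> * s) * norm (f s)))))))"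
proof (intro conjI exI[of _ "\<lambda>x. \<omega> / M - x * norm B"] allI impI)
  show "0 < delay_threshold \<tau> M \<omega> B"
    using \<open>M > 0\<close> \<open>\<omega> > 0\<close> \<open>\<tau> > 0\<close> by (rule delay_threshold_pos)
next
  fix k assume k: "ereal \<bar>k\<bar> < delay_threshold \<tau> M \<omega> B"
  then show "0 < \<omega> / M - \<bar>k\<bar> * norm B"
    using delay_gain_less_decay_rate[OF \<open>M > 0\<close> \<open>\<omega> > 0\<close> \<open>\<tau> > 0\<close> k] \<open>M > 0\<close>
    by (simp add: pos_less_divide_eq mult_ac)
next
  fix k \<gamma> :: real and F :: "'a \<Rightarrow> 'a"
  assume "F 0 = 0" and "0 < \<gamma>" and \<gamma>: "\<gamma> < \<omega> / M - \<bar>k\<bar> * norm B"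
    and lip: "\<forall>U1 U2. norm (F U1 - F U2) \<le> \<gamma> * norm (U1 - U2)"
  have F: "norm (F x) \<le> \<gamma> * norm x" for x
    using lip[rule_format, of x 0] \<open>F 0 = 0\<close> by simp
  have "M * (\<gamma> + \<bar>k\<bar> * norm B) < \<omega>"
    using \<gamma> \<open>M > 0\<close> by (simp add: field_simps)
  then obtain \<omega>' where "\<omega>' > 0"
    and rate: "M * (\<gamma> + \<bar>k\<bar> * norm B * exp (\<omega>' * \<tau>)) < \<omega> - \<omega>'"
    by (rule exists_decay_rate)
  define q where "q = M * (\<gamma> + \<bar>k\<bar> * norm B * exp (\<omega>' * \<tau>)) / (\<omega> - \<omega>')"
  have "0 \<le> M * (\<gamma> + \<bar>k\<bar> * norm B * exp (\<omega>' * \<tau>))"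
    using \<open>M > 0\<close> \<open>0 < \<gamma>\<close> by simp
  then have "0 < \<omega> - \<omega>'" using rate by linarith
  then have "q < 1" using rate by (simp add: q_def)
  then have M': "M * (1 + \<bar>k\<bar>) / (1 - q) > 0"
    using \<open>M > 0\<close> by (simp add: add_pos_nonneg)
  have decay: "norm (U t) \<le> M * (1 + \<bar>k\<bar>) / (1 - q) * exp (- \<omega>' * t) *
      (norm U0 + integral {0..\<tau>} (\<lambda>s. exp (\<omega> * s) * norm (f s)))"
    if "continuous_on {0..\<tau>} f" "mild_solution S F k B \<tau> U0 f U" "t \<ge> \<tau>" for U0 f U t
    unfolding q_def
    by (rule mild_solution_decay[OF stable \<open>M > 0\<close> \<open>\<tau> > 0\<close> \<open>0 < \<gamma>\<close> F rate that(1,2)])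
      (use that(3) \<open>\<tau> > 0\<close> in auto)
  show "\<exists>\<omega>'>0. \<exists>M'>0. \<forall>(U0 :: 'a) (f :: real \<Rightarrow> 'a) (U :: real \<Rightarrow> 'a).
      continuous_on {0..\<tau>} f \<longrightarrow> mild_solution S F k B \<tau> U0 f U \<longrightarrow>
      (\<forall>t\<ge>\<tau>. norm (U t) \<le> M' * exp (- \<omega>' * t) *
        (norm U0 + integral {0..\<tau>} (\<lambda>s. exp (\<omega> * s) * norm (f s))))"
    using \<open>\<omega>' > 0\<close> M' decay by blast
qed

end
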